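(* Let $M$ be a connected matroid of rank $k$ on a finite set $E$, and let $\mathfrak{S}\subseteq\mathcal{P}(E)$ be a collection of subsets of $E$ such that: (i) $\mathfrak{S}$ contains every set $S\subseteq E$ for which both the restriction $M|_S$ and the contraction $M/S$ are connected; and (ii) whenever $S\in\mathfrak{S}$, all of the connected components of $M|_S$ are also in $\mathfrak{S}$. Then $\operatorname{ec}_{\mathfrak{S}}(M)=\operatorname{ec}(M)$.
   Context: For a matroid $M$ of rank $k$ on a finite set $E$ with rank function $\operatorname{rk}$, put $c(S)=\#S-\operatorname{rk}S$ for $S\subseteq E$. For a collection $\mathfrak{S}\subseteq\mathcal{P}(E)$ define $a_{\mathfrak{S}}$ on $\mathfrak{S}$ recursively by $a_{\mathfrak{S}}(S)=c(S)-\sum_{T\in\mathfrak{S},\,T\subsetneq S}a_{\mathfrak{S}}(T)$ (with $a_{\mathfrak{S}}(\varnothing)=0$), and the expected codimension of $M$ with respect to $\mathfrak{S}$ by $\operatorname{ec}_{\mathfrak{S}}(M)=\sum_{S\in\mathfrak{S}}(k-\operatorname{rk}S)\,a_{\mathfrak{S}}(S)$. The expected codimension is $\operatorname{ec}(M)=\operatorname{ec}_{\mathcal{P}(E)}(M)$. $M|_S$ is the matroid on $S$ whose rank function is the restriction of that of $M$; $M/S$ is the matroid on $E\setminus S$ with rank function $T\mapsto\operatorname{rk}(T\cup S)-\operatorname{rk}(S)$. A matroid on $E$ is connected if it is not a direct sum of two matroids on nonempty ground sets, equivalently if there is no proper nonempty subset $S\subsetneq E$ with $\operatorname{rk}S+\operatorname{rk}(E\setminus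 S)=\operatorname{rk}E$ (so the matroid on the empty set counts as connected). Every matroid is uniquely a direct sum of connected matroids on nonempty sets, whose ground sets are its connected components. *)

theory Defs
  imports "HOL-Library.Disjoint_Sets"
begin

text \<open>
  Matroids on finite sets, given by their rank functions. Only the values of \<open>rk M\<close> on subsets
  of \<open>ground M\<close> are meaningful, so identities between matroids are stated on those subsets.
\<close>

record 'a matroid =
  ground :: "'a set"
  rk :: "'a set \<Rightarrow> nat"

definition is_matroid :: "'a matroid \<Rightarrow> bool" where
  "is_matroid M \<longleftrightarrow>
     finite (ground M) \<and>
     (\<forall>A. A \<subseteq> ground M \<longrightarrow> rk M A \<le> card A) \<and>
     (\<forall>A B. A \<subseteq> B \<longrightarrow> B \<subseteq> ground M \<longrightarrow> rk M A \<le> rk M B) \<and>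
     (\<forall>A B. A \<subseteq> ground M \<longrightarrow> B \<subseteq> ground M \<longrightarrow>
        rk M (A \<union> B) + rk M (A \<inter> B) \<le> rk M A + rk M B)"

definition restriction :: "'a matroid \<Rightarrow> 'a set \<Rightarrow> 'a matroid" where
  "restriction M S = \<lparr>ground = S, rk = rk M\<rparr>"

definition contraction :: "'a matroid \<Rightarrow> 'a set \<Rightarrow> 'a matroid" where
  "contraction M S = \<lparr>ground = ground M - S, rk = (\<lambda>T. rk M (T \<union> S) - rk M S)\<rparr>"

text \<open>The (internal) direct sum of a finite family of matroids on disjoint ground sets.\<close>

definition is_direct_sum :: "'a matroid \<Rightarrow> 'i set \<Rightarrow> ('i \<Rightarrow> 'a matroid) \<Rightarrow> bool" where
  "is_direct_sum M I N \<longleftrightarrow>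
     finite I \<and> (\<forall>i\<in>I. is_matroid (N i)) \<and>
     disjoint_family_on (\<lambda>i. ground (N i)) I \<and>
     ground M = (\<Union>i\<in>I. ground (N i)) \<and>
     (\<forall>T. T \<subseteq> ground M \<longrightarrow> rk M T = (\<Sum>i\<in>I. rk (N i) (T \<inter> ground (N i))))"

definition matroid_connected :: "'a matroid \<Rightarrow> bool" where
  "matroid_connected M \<longleftrightarrow>
     \<not> (\<exists>N. is_direct_sum M {0, 1 :: nat} N \<and> ground (N 0) \<noteq> {} \<and> ground (N 1) \<noteq> {})"

definition connected_component_of :: "'a set \<Rightarrow> 'a matroid \<Rightarrow> bool" where
  "connected_component_of C M \<longleftrightarrow>
     (\<exists>(I :: nat set) N. is_direct_sum M I N \<and>
        (\<forall>i\<in>I. ground (N i) \<noteq> {} \<and> matroid_connected (N i)) \<and>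
        (\<exists>i\<in>I. C = ground (N i)))"

definition nullity :: "'a matroid \<Rightarrow> 'a set \<Rightarrow> int" where
  "nullity M S = int (card S) - int (rk M S)"

text \<open>
  The guard \<open>finite S\<close> is only there for termination. The convention that the value at the
  empty set is \<open>0\<close> need not be imposed separately: see \<open>coeff_empty\<close> below.
\<close>

function coeff :: "'a set set \<Rightarrow> 'a matroid \<Rightarrow> 'a set \<Rightarrow> int" where
  "coeff SS M S =
     (if finite S then nullity M S - (\<Sum>T\<in>{T \<in> SS. T \<subset> S}. coeff SS M T) else 0)"
  by pat_completeness auto
termination
  by (relation "measure (\<lambda>(SS, M, S). card S)") (auto simp: psubset_card_mono)

declare coeff.simps [simp del]

definition expected_codim_wrt :: "'a set set \<Rightarrow> 'a matroid \<Rightarrow> int" where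
  "expected_codim_wrt SS M =
     (\<Sum>S\<in>SS. (int (rk M (ground M)) - int (rk M S)) * coeff SS M S)"

definition expected_codim :: "'a matroid \<Rightarrow> int" where
  "expected_codim M = expected_codim_wrt (Pow (ground M)) M"

lemma is_matroid_rk_empty: "is_matroid M \<Longrightarrow> rk M {} = 0"
  unfolding is_matroid_def by (metis card.empty empty_subsetI le_zero_eq)

lemma coeff_empty: "is_matroid M \<Longrightarrow> coeff SS M {} = 0"
  by (subst coeff.simps) (simp add: nullity_def is_matroid_rk_empty)

lemma is_matroid_restriction:
  assumes "is_matroid M" "S \<subseteq> ground M"
  shows "is_matroid (restriction M S)"
  using assms unfolding is_matroid_def restriction_def
  by (auto intro: finite_subset dest: subset_trans[of _ S "ground M"])

lemma is_matroid_contraction: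
  assumes M: "is_matroid M" and S: "S \<subseteq> ground M"
  shows "is_matroid (contraction M S)"
proof -
  have fin: "finite (ground M)"
    and card: "\<And>A. A \<subseteq> ground M \<Longrightarrow> rk M A \<le> card A"
    and mono: "\<And>A B. A \<subseteq> B \<Longrightarrow> B \<subseteq> ground M \<Longrightarrow> rk M A \<le> rk M B"
    and sub: "\<And>A B. A \<subseteq> ground M \<Longrightarrow> B \<subseteq> ground M \<Longrightarrow>
        rk M (A \<union> B) + rk M (A \<inter> B) \<le> rk M A + rk M B"
    using M unfolding is_matroid_def by blast+
  have "rk M (A \<union> S) - rk M S \<le> card A" if "A \<subseteq> ground M - S" for A
  proof -
    have "A \<subseteq> ground M" using that by blast
    then show ?thesis using sub[of A S] card[of A] S by linarith
  qed
  moreover have "rk M (A \<union> S) - rk M S \<le> rk M (B \<union> S) - rk M S"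
    if "A \<subseteq> B" "B \<subseteq> ground M - S" for A B
    using that S by (intro diff_le_mono mono) auto
  moreover have "(rk M (A \<union> B \<union> S) - rk M S) + (rk M (A \<inter> B \<union> S) - rk M S)
      \<le> (rk M (A \<union> S) - rk M S) + (rk M (B \<union> S) - rk M S)"
    if "A \<subseteq> ground M - S" "B \<subseteq> ground M - S" for A B
  proof -
    have "A \<union> S \<subseteq> ground M" "B \<union> S \<subseteq> ground M" "A \<inter> B \<union> S \<subseteq> ground M"
      "A \<union> B \<union> S \<subseteq> ground M" using that S by auto
    moreover have "(A \<union> S) \<union> (B \<union> S) = A \<union> B \<union> S" "(A \<union> S) \<inter> (B \<union> S) = A \<inter> B \<union> S" by auto
    ultimately show ?thesis
      using sub[of "A \<union> S" "B \<union> S"] mono[of S "A \<union> S"] mono[of S "B \<union> S"]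
        mono[of S "A \<union> B \<union> S"] mono[of S "A \<inter> B \<union> S"] by auto
  qed
  ultimately show ?thesis
    using fin unfolding is_matroid_def contraction_def by simp
qed

lemma matroid_connected_iff:
  assumes M: "is_matroid M"
  shows "matroid_connected M \<longleftrightarrow>
    \<not> (\<exists>S. S \<noteq> {} \<and> S \<subset> ground M \<and> rk M S + rk M (ground M - S) = rk M (ground M))"
proof -
  have mono: "\<And>A B. A \<subseteq> B \<Longrightarrow> B \<subseteq> ground M \<Longrightarrow> rk M A \<le> rk M B"
    and sub: "\<And>A B. A \<subseteq> ground M \<Longrightarrow> B \<subseteq> ground M \<Longrightarrow>
        rk M (A \<union> B) + rk M (A \<inter> B) \<le> rk M A + rk M B"
    using M unfolding is_matroid_def by blast+
  have emp: "rk M {} = 0" by (rule is_matroid_rk_empty[OF M])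
  show ?thesis
  proof (intro iffI notI)
    assume con: "matroid_connected M"
      and "\<exists>S. S \<noteq> {} \<and> S \<subset> ground M \<and> rk M S + rk M (ground M - S) = rk M (ground M)"
    then obtain S where S: "S \<noteq> {}" "S \<subset> ground M"
      and eq: "rk M S + rk M (ground M - S) = rk M (ground M)" by blast
    define N where "N i = restriction M (if i = (0::nat) then S else ground M - S)" for i
    have "rk M T = rk M (T \<inter> S) + rk M (T \<inter> (ground M - S))" if T: "T \<subseteq> ground M" for T
    proof -
      have "rk M T \<le> rk M (T \<inter> S) + rk M (T \<inter> (ground M - S))"
      proof -
        have "(T \<inter> S) \<union> (T \<inter> (ground M - S)) = T" "(T \<inter> S) \<inter> (T \<inter> (ground M - S)) = {}"
          using T by auto
        then show ?thesis
          using sub[of "T \<inter> S" "T \<inter> (ground M - S)"] T emp by auto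
      qed
      moreover have "rk M (T \<union> S) + rk M (T \<inter> S) \<le> rk M T + rk M S"
        using sub[of T S] T S by auto
      moreover have "rk M (ground M) + rk M (T \<inter> (ground M - S))
          \<le> rk M (T \<union> S) + rk M (ground M - S)"
      proof -
        have "(T \<union> S) \<union> (ground M - S) = ground M"
          "(T \<union> S) \<inter> (ground M - S) = T \<inter> (ground M - S)" using T S by auto
        then show ?thesis using sub[of "T \<union> S" "ground M - S"] T S by auto
      qed
      ultimately show ?thesis using eq by linarith
    qed
    then have "is_direct_sum M {0, 1} N"
      using S unfolding is_direct_sum_def N_def
      by (auto simp: is_matroid_restriction[OF M] disjoint_family_on_def restriction_def
          split: if_splits)
        (simp_all add: is_matroid_restriction[OF M, unfolded restriction_def] psubset_imp_subset)
    moreover have "ground (N 0) \<noteq> {}" "ground (N 1) \<noteq> {}"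
      using S by (auto simp: N_def restriction_def)
    ultimately show False using con unfolding matroid_connected_def by blast
  next
    assume none: "\<not> (\<exists>S. S \<noteq> {} \<and> S \<subset> ground M \<and>
        rk M S + rk M (ground M - S) = rk M (ground M))"
    show "matroid_connected M"
      unfolding matroid_connected_def
    proof
      assume "\<exists>N. is_direct_sum M {0, 1 :: nat} N \<and> ground (N 0) \<noteq> {} \<and> ground (N 1) \<noteq> {}"
      then obtain N where ds: "is_direct_sum M {0, 1 :: nat} N"
        and ne: "ground (N 0) \<noteq> {}" "ground (N 1) \<noteq> {}" by blast
      let ?A = "ground (N 0)" and ?B = "ground (N 1)"
      have mat: "is_matroid (N 0)" "is_matroid (N 1)"
        and disj: "?A \<inter> ?B = {}" and gr: "ground M = ?A \<union> ?B"
        and rk: "\<And>T. T \<subseteq> ground M \<Longrightarrow> rk M T = rk (N 0) (T \<inter> ?A) + rk (N 1) (T \<inter> ?B)"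
        using ds unfolding is_direct_sum_def disjoint_family_on_def by auto
      have e: "rk (N 0) {} = 0" "rk (N 1) {} = 0" using mat is_matroid_rk_empty by blast+
      have "ground M - ?A = ?B" "?B \<inter> ?A = {}" "(?A \<union> ?B) \<inter> ?A = ?A" "(?A \<union> ?B) \<inter> ?B = ?B"
        using gr disj by auto
      then have "rk M ?A + rk M (ground M - ?A) = rk M (ground M)"
        using rk[of ?A] rk[of ?B] rk[of "ground M"] gr disj e by simp
      moreover have "?A \<subset> ground M" using gr disj ne by blast
      ultimately show False using none ne by blast
    qed
  qed
qed

end

theory Submission
  imports Defs
begin

text \<open>
  Let \<open>M\<close> have rank \<open>k\<close> and ground set \<open>E\<close>, and write \<open>c\<close> for the nullity. Write \<open>a\<close> for the
  coefficients of a family \<open>F\<close>, so that \<open>c(S)\<close> is the sum of \<open>a(T)\<close> over the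
  \<open>T \<in> F\<close> inside \<open>S\<close>, for every \<open>S \<in> F\<close>. Two facts about the expected codimension carry the proof.

  \<^item> \<^emph>\<open>Only connected sets matter.\<close> Nullity is additive over the components of \<open>M|S\<close>, and a
    nonempty subset of \<open>S\<close> with connected restriction lies in a single component. So, if \<open>F\<close> contains the
    components of its members, the components of a disconnected \<open>S\<close> already account for all of
    \<open>c(S)\<close>, and \<open>a(S) = 0\<close> (\<open>coeff_disconnected\<close>). Such sets can be deleted from \<open>F\<close>
    (\<open>expected_codim_wrt_connected_members\<close>).

  \<^item> \<^emph>\<open>Duality.\<close> In the definition of the expected codimension the factor \<open>k - rk S\<close> is the nullity
    of \<open>E - S\<close> in the dual matroid. Expanding it through the coefficients of the family of
    complements in the dual gives an expression that is symmetric under duality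
    (\<open>expected_codim_wrt_dual\<close>).

  Now delete from \<open>SS\<close> the sets with disconnected restriction, pass to the dual, and delete again.
  A set \<open>S\<close> is lost in the second deletion when \<open>M/S\<close> is disconnected, because \<open>M/S\<close> is dual to the
  restriction of the dual matroid to \<open>E - S\<close>. That deletion needs the complements to be closed
  under components in the dual; this is where the connectedness of \<open>M\<close> enters, together with the
  assumption that \<open>SS\<close> contains every set with connected restriction and contraction
  (\<open>contraction_component_connected\<close>). What survives is exactly the family of all sets \<open>S\<close> with
  both \<open>M|S\<close> and \<open>M/S\<close> connected, whatever \<open>SS\<close> was, so \<open>SS\<close> and the full power set give the same
  number.
\<close>

section \<open>Rank functions and connectedness\<close>

lemma matroid_finite: "is_matroid M \<Longrightarrow> finite (ground M)"
  unfolding is_matroid_def by blast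

lemma rk_le_card: "is_matroid M \<Longrightarrow> A \<subseteq> ground M \<Longrightarrow> rk M A \<le> card A"
  unfolding is_matroid_def by blast

lemma rk_mono: "is_matroid M \<Longrightarrow> A \<subseteq> B \<Longrightarrow> B \<subseteq> ground M \<Longrightarrow> rk M A \<le> rk M B"
  unfolding is_matroid_def by blast

lemma rk_submodular:
  "is_matroid M \<Longrightarrow> A \<subseteq> ground M \<Longrightarrow> B \<subseteq> ground M \<Longrightarrow>
    rk M (A \<union> B) + rk M (A \<inter> B) \<le> rk M A + rk M B"
  unfolding is_matroid_def by blast

lemma connected_restriction_iff:
  assumes "is_matroid M" "S \<subseteq> ground M"
  shows "matroid_connected (restriction M S) \<longleftrightarrow>
    \<not> (\<exists>A. A \<noteq> {} \<and> A \<subset> S \<and> rk M A + rk M (S - A) = rk M S)"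
  using matroid_connected_iff[OF is_matroid_restriction[OF assms]]
  by (simp add: restriction_def)

lemma connected_contraction_iff:
  assumes M: "is_matroid M" and S: "S \<subseteq> ground M"
  shows "matroid_connected (contraction M S) \<longleftrightarrow>
    \<not> (\<exists>A. A \<noteq> {} \<and> A \<subset> ground M - S \<and>
          rk M (A \<union> S) + rk M (ground M - A) = rk M (ground M) + rk M S)"
proof -
  have "(rk M (A \<union> S) - rk M S) + (rk M (ground M - S - A \<union> S) - rk M S)
          = rk M (ground M - S \<union> S) - rk M S
        \<longleftrightarrow> rk M (A \<union> S) + rk M (ground M - A) = rk M (ground M) + rk M S"
    if "A \<subset> ground M - S" for A
  proof -
    have eq: "ground M - S - A \<union> S = ground M - A" "ground M - S \<union> S = ground M"
      using that S by auto
    have "rk M S \<le> rk M (A \<union> S)" "rk M S \<le> rk M (ground M - A)" "rk M S \<le> rk M (ground M)"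
      using that S by (auto intro!: rk_mono[OF M])
    then show ?thesis unfolding eq by linarith
  qed
  then show ?thesis
    using matroid_connected_iff[OF is_matroid_contraction[OF M S]]
    by (auto simp: contraction_def)
qed

text \<open>
  Additivity on \<open>S\<close> alone forces additivity on all subsets \<open>T\<close>. One inequality is subadditivity. For
  the other, enlarge \<open>T\<close> first to \<open>T \<union> A\<close> and then to \<open>S\<close>: by submodularity the defect
  \<open>rk (T \<inter> A) + rk (T - A) - rk T\<close> can only grow, and on \<open>S\<close> it is zero.
\<close>

lemma separator_additive:
  assumes M: "is_matroid M" and S: "S \<subseteq> ground M" and A: "A \<subseteq> S"
    and sep: "rk M A + rk M (S - A) = rk M S" and T: "T \<subseteq> S"
  shows "rk M T = rk M (T \<inter> A) + rk M (T \<inter> (S - A))"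
proof (rule antisym)
  have "(T \<inter> A) \<union> (T \<inter> (S - A)) = T" "(T \<inter> A) \<inter> (T \<inter> (S - A)) = {}"
    using T by auto
  then show "rk M T \<le> rk M (T \<inter> A) + rk M (T \<inter> (S - A))"
    using rk_submodular[OF M, of "T \<inter> A" "T \<inter> (S - A)"] T S is_matroid_rk_empty[OF M]
    by fastforce
next
  have sub: "T \<subseteq> ground M" "A \<subseteq> ground M" "T \<union> A \<subseteq> ground M" "S - A \<subseteq> ground M"
    using T A S by auto
  have "rk M (T \<union> A) + rk M (T \<inter> A) \<le> rk M T + rk M A"
    using rk_submodular[OF M sub(1,2)] .
  moreover have un: "(T \<union> A) \<union> (S - A) = S" "(T \<union> A) \<inter> (S - A) = T \<inter> (S - A)"
    using T A by auto
  have "rk M S + rk M (T \<inter> (S - A)) \<le> rk M (T \<union> A) + rk M (S - A)"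
    using rk_submodular[OF M sub(3,4)] unfolding un .
  ultimately show "rk M (T \<inter> A) + rk M (T \<inter> (S - A)) \<le> rk M T"
    using sep by linarith
qed

section \<open>Connected components\<close>

lemma connected_component_ofD:
  assumes M: "is_matroid M" and S: "S \<subseteq> ground M"
    and C: "connected_component_of C (restriction M S)"
  shows "C \<subseteq> S" and "matroid_connected (restriction M C)"
    and "rk M C + rk M (S - C) = rk M S"
proof -
  obtain I :: "nat set" and N i where ds: "is_direct_sum (restriction M S) I N"
    and con: "\<And>j. j \<in> I \<Longrightarrow> matroid_connected (N j)" and i: "i \<in> I" and Ci: "C = ground (N i)"
    using C unfolding connected_component_of_def by blast
  have fin: "finite I" and mat: "\<And>j. j \<in> I \<Longrightarrow> is_matroid (N j)"
    and disj: "\<And>j l. j \<in> I \<Longrightarrow> l \<in> I \<Longrightarrow> j \<noteq> l \<Longrightarrow> ground (N j) \<inter> ground (N l) = {}"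
    and SU: "S = (\<Union>j\<in>I. ground (N j))"
    and rk: "\<And>T. T \<subseteq> S \<Longrightarrow> rk M T = (\<Sum>j\<in>I. rk (N j) (T \<inter> ground (N j)))"
    using ds unfolding is_direct_sum_def disjoint_family_on_def restriction_def by auto
  show CS: "C \<subseteq> S" using SU Ci i by blast
  have rkC: "rk M T = rk (N i) T" if T: "T \<subseteq> C" for T
  proof -
    have "rk (N j) (T \<inter> ground (N j)) = (if j = i then rk (N i) T else 0)" if "j \<in> I" for j
    proof (cases "j = i")
      case True then show ?thesis using T Ci by (simp add: Int_absorb2)
    next
      case False
      then have "T \<inter> ground (N j) = {}" using disj[OF that i] T Ci by blast
      then show ?thesis using False is_matroid_rk_empty[OF mat[OF that]] by simp
    qed
    then show ?thesis using rk[of T] T CS fin i by (simp add: sum.delta)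
  qed
  have CE: "C \<subseteq> ground M" using CS S by blast
  have "matroid_connected (N i)" using con i by blast
  then show "matroid_connected (restriction M C)"
    unfolding connected_restriction_iff[OF M CE] matroid_connected_iff[OF mat[OF i]]
    using rkC Ci by (metis Diff_subset order_refl psubset_imp_subset)
  have "rk M S = (\<Sum>j\<in>I. rk (N j) (S \<inter> ground (N j)))" using rk by blast
  also have "\<dots> = (\<Sum>j\<in>I. rk (N j) (C \<inter> ground (N j)) + rk (N j) ((S - C) \<inter> ground (N j)))"
  proof (rule sum.cong[OF refl])
    fix j assume j: "j \<in> I"
    have e: "rk (N j) {} = 0" using is_matroid_rk_empty[OF mat[OF j]] .
    show "rk (N j) (S \<inter> ground (N j))
        = rk (N j) (C \<inter> ground (N j)) + rk (N j) ((S - C) \<inter> ground (N j))"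
    proof (cases "j = i")
      case True
      then have "(S - C) \<inter> ground (N j) = {}" "S \<inter> ground (N j) = C \<inter> ground (N j)"
        using Ci CS by auto
      then show ?thesis using e by simp
    next
      case False
      then have "C \<inter> ground (N j) = {}" "(S - C) \<inter> ground (N j) = S \<inter> ground (N j)"
        using disj[OF j i] Ci by auto
      then show ?thesis using e by simp
    qed
  qed
  also have "\<dots> = rk M C + rk M (S - C)"
    using rk[OF CS] rk[of "S - C"] by (simp add: sum.distrib)
  finally show "rk M C + rk M (S - C) = rk M S" by simp
qed

lemma connected_partition_exists:
  assumes M: "is_matroid M" and S: "S \<subseteq> ground M"
  shows "\<exists>P. finite P \<and> partition_on S P \<and> (\<forall>C\<in>P. matroid_connected (restriction M C)) \<and>
    (\<forall>T\<subseteq>S. rk M T = (\<Sum>C\<in>P. rk M (T \<inter> C)))"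
  using S
proof (induction "card S" arbitrary: S rule: less_induct)
  case less
  have finS: "finite S" using less.prems matroid_finite[OF M] finite_subset by blast
  consider "S = {}" | "S \<noteq> {}" "matroid_connected (restriction M S)"
    | "\<not> matroid_connected (restriction M S)" by blast
  then show ?case
  proof cases
    case 1
    then show ?thesis using is_matroid_rk_empty[OF M]
      by (intro exI[of _ "{}"]) (auto simp: partition_on_def)
  next
    case 2
    then show ?thesis
      by (intro exI[of _ "{S}"]) (auto simp: partition_on_def disjoint_def Int_absorb2)
  next
    case 3
    then obtain A where A: "A \<noteq> {}" "A \<subset> S" and sep: "rk M A + rk M (S - A) = rk M S"
      using connected_restriction_iff[OF M less.prems] by blast
    have less_card: "card A < card S" "card (S - A) < card S"
      using A finS by (auto intro!: psubset_card_mono)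
    have sub: "A \<subseteq> ground M" "S - A \<subseteq> ground M" using A less.prems by auto
    have
      "\<exists>P. finite P \<and> partition_on A P \<and> (\<forall>C\<in>P. matroid_connected (restriction M C)) \<and>
        (\<forall>T\<subseteq>A. rk M T = (\<Sum>C\<in>P. rk M (T \<inter> C)))"
      "\<exists>Q. finite Q \<and> partition_on (S - A) Q \<and> (\<forall>C\<in>Q. matroid_connected (restriction M C)) \<and>
        (\<forall>T\<subseteq>S - A. rk M T = (\<Sum>C\<in>Q. rk M (T \<inter> C)))"
      by (rule less.hyps[OF less_card(1) sub(1)], rule less.hyps[OF less_card(2) sub(2)])
    then obtain P Q
      where P: "finite P" "partition_on A P" "\<forall>C\<in>P. matroid_connected (restriction M C)"
          "\<forall>T\<subseteq>A. rk M T = (\<Sum>C\<in>P. rk M (T \<inter> C))"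
        and Q: "finite Q" "partition_on (S - A) Q" "\<forall>C\<in>Q. matroid_connected (restriction M C)"
          "\<forall>T\<subseteq>S - A. rk M T = (\<Sum>C\<in>Q. rk M (T \<inter> C))"
      by (elim exE conjE)
    have PA: "C \<subseteq> A" if "C \<in> P" for C using P(2) that by (auto simp: partition_on_def)
    have QA: "C \<subseteq> S - A" "C \<noteq> {}" if "C \<in> Q" for C using Q(2) that by (auto simp: partition_on_def)
    have PQ: "P \<inter> Q = {}" using PA QA by blast
    have part: "partition_on S (P \<union> Q)"
    proof -
      have "\<Union>(P \<union> Q) = S" using P(2) Q(2) A by (auto simp: partition_on_def)
      moreover have "disjoint (P \<union> Q)"
        using P(2) Q(2) by (intro disjoint_union) (auto simp: partition_on_def)
      moreover have "{} \<notin> P \<union> Q" using P(2) Q(2) by (auto simp: partition_on_def)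
      ultimately show ?thesis by (simp add: partition_on_def)
    qed
    have "rk M T = (\<Sum>C\<in>P \<union> Q. rk M (T \<inter> C))" if T: "T \<subseteq> S" for T
    proof -
      have "rk M T = rk M (T \<inter> A) + rk M (T \<inter> (S - A))"
        using separator_additive[OF M less.prems _ sep T] A by auto
      also have "\<dots> = (\<Sum>C\<in>P. rk M (T \<inter> A \<inter> C)) + (\<Sum>C\<in>Q. rk M (T \<inter> (S - A) \<inter> C))"
        using P(4)[rule_format, of "T \<inter> A"] Q(4)[rule_format, of "T \<inter> (S - A)"] by simp
      also have "\<dots> = (\<Sum>C\<in>P. rk M (T \<inter> C)) + (\<Sum>C\<in>Q. rk M (T \<inter> C))"
      proof -
        have "T \<inter> A \<inter> C = T \<inter> C" if "C \<in> P" for C using PA[OF that] by blast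
        moreover have "T \<inter> (S - A) \<inter> C = T \<inter> C" if "C \<in> Q" for C using QA(1)[OF that] by blast
        ultimately show ?thesis by simp
      qed
      finally show ?thesis using P(1) Q(1) PQ by (simp add: sum.union_disjoint)
    qed
    moreover have "\<forall>C\<in>P \<union> Q. matroid_connected (restriction M C)" using P(3) Q(3) by blast
    moreover have "finite (P \<union> Q)" using P(1) Q(1) by blast
    ultimately show ?thesis using part by blast
  qed
qed

lemma component_decomposition:
  assumes M: "is_matroid M" and S: "S \<subseteq> ground M"
  obtains P where "finite P" "partition_on S P"
    "\<And>C. C \<in> P \<Longrightarrow> connected_component_of C (restriction M S)"
    "\<And>T. T \<subseteq> S \<Longrightarrow> rk M T = (\<Sum>C\<in>P. rk M (T \<inter> C))"
proof -
  obtain P where fin: "finite P" and part: "partition_on S P"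
    and con: "\<And>C. C \<in> P \<Longrightarrow> matroid_connected (restriction M C)"
    and rk: "\<And>T. T \<subseteq> S \<Longrightarrow> rk M T = (\<Sum>C\<in>P. rk M (T \<inter> C))"
    using connected_partition_exists[OF assms] by blast
  have PS: "\<Union>P = S" "disjoint P" "{} \<notin> P" using part by (auto simp: partition_on_def)
  obtain f where f: "bij_betw f {0..<card P} P" using ex_bij_betw_nat_finite[OF fin] by blast
  define N where "N i = restriction M (f i)" for i
  have fP: "f i \<in> P" if "i < card P" for i using f that by (auto simp: bij_betw_def)
  have im: "f ` {0..<card P} = P" and inj: "inj_on f {0..<card P}"
    using f by (auto simp: bij_betw_def)
  have ds: "is_direct_sum (restriction M S) {0..<card P} N"
    unfolding is_direct_sum_def
  proof (intro conjI ballI allI impI)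
    show "is_matroid (N i)" if "i \<in> {0..<card P}" for i
    proof -
      have "f i \<in> P" using fP that by simp
      then have "f i \<subseteq> ground M" using PS(1) S by blast
      then show ?thesis unfolding N_def by (rule is_matroid_restriction[OF M])
    qed
    show "disjoint_family_on (\<lambda>i. ground (N i)) {0..<card P}"
    proof (unfold disjoint_family_on_def, intro ballI impI)
      fix i j assume ij: "i \<in> {0..<card P}" "j \<in> {0..<card P}" "i \<noteq> j"
      then have "f i \<noteq> f j" "f i \<in> P" "f j \<in> P" using inj fP by (auto dest: inj_onD)
      then show "ground (N i) \<inter> ground (N j) = {}"
        using PS(2) by (auto simp: disjoint_def N_def restriction_def)
    qed
    show "ground (restriction M S) = (\<Union>i\<in>{0..<card P}. ground (N i))"
      using PS(1) im by (auto simp: N_def restriction_def)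
    show "rk (restriction M S) T = (\<Sum>i\<in>{0..<card P}. rk (N i) (T \<inter> ground (N i)))"
      if "T \<subseteq> ground (restriction M S)" for T
      using rk[of T] that sum.reindex_bij_betw[OF f, of "\<lambda>C. rk M (T \<inter> C)"]
      by (simp add: N_def restriction_def)
  qed simp
  have conN: "\<forall>i\<in>{0..<card P}. ground (N i) \<noteq> {} \<and> matroid_connected (N i)"
  proof
    fix i assume i: "i \<in> {0..<card P}"
    then have "f i \<in> P" using fP by simp
    then show "ground (N i) \<noteq> {} \<and> matroid_connected (N i)"
      using con PS(3) by (auto simp: N_def restriction_def)
  qed
  have "\<exists>i\<in>{0..<card P}. C = ground (N i)" if "C \<in> P" for C
    using that im by (auto simp: N_def restriction_def)
  then have "connected_component_of C (restriction M S)" if "C \<in> P" for C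
    unfolding connected_component_of_def using ds conN that by meson
  then show ?thesis using that fin part rk by blast
qed

section \<open>Deleting sets with disconnected restriction\<close>

lemma sum_coeff_subsets:
  assumes "finite S" "S \<in> F"
  shows "(\<Sum>T\<in>{T \<in> F. T \<subseteq> S}. coeff F M T) = nullity M S"
proof -
  have "{T \<in> F. T \<subseteq> S} = insert S {T \<in> F. T \<subset> S}" using assms(2) by auto
  moreover have "finite {T \<in> F. T \<subset> S}"
    using assms(1) by (auto intro: finite_subset[of _ "Pow S"])
  ultimately show ?thesis using assms(1) coeff.simps[of F M S] by simp
qed

lemma expected_codim_wrt_delete_zeros:
  assumes fin: "finite F" "\<And>S. S \<in> F \<Longrightarrow> finite S" and sub: "G \<subseteq> F"
    and zero: "\<And>S. S \<in> F - G \<Longrightarrow> coeff F M S = 0"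
  shows "expected_codim_wrt F M = expected_codim_wrt G M"
proof -
  have eq: "coeff F M S = coeff G M S" if "finite S" for S
    using that
  proof (induction S rule: finite_psubset_induct)
    case (psubset S)
    have "(\<Sum>T\<in>{T \<in> F. T \<subset> S}. coeff F M T) = (\<Sum>T\<in>{T \<in> G. T \<subset> S}. coeff F M T)"
      using fin(1) sub zero by (intro sum.mono_neutral_right) auto
    also have "\<dots> = (\<Sum>T\<in>{T \<in> G. T \<subset> S}. coeff G M T)"
      using psubset.IH by (intro sum.cong) auto
    finally show ?case by (simp add: coeff.simps[of _ M S])
  qed
  have "expected_codim_wrt F M
      = (\<Sum>S\<in>G. (int (rk M (ground M)) - int (rk M S)) * coeff F M S)"
    unfolding expected_codim_wrt_def
    using fin(1) sub zero by (intro sum.mono_neutral_right) auto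
  also have "\<dots> = expected_codim_wrt G M"
    unfolding expected_codim_wrt_def using eq fin(2) sub by (intro sum.cong) auto
  finally show ?thesis .
qed

text \<open>
  By induction the proper subsets of \<open>S\<close> with nonzero coefficient are nonempty and connected, so
  each lies in exactly one component of \<open>S\<close>. Summed over the components, their coefficients give
  \<open>c(S)\<close>, and nothing is left for \<open>S\<close> itself.
\<close>

lemma coeff_disconnected:
  assumes M: "is_matroid M" and F: "F \<subseteq> Pow (ground M)"
    and comp: "\<And>S C. S \<in> F \<Longrightarrow> connected_component_of C (restriction M S) \<Longrightarrow> C \<in> F"
    and S: "S \<in> F" and disc: "\<not> matroid_connected (restriction M S)"
  shows "coeff F M S = 0"
  using S disc
proof (induction "card S" arbitrary: S rule: less_induct)
  case less
  have SE: "S \<subseteq> ground M" using F less.prems(1) by blast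
  have finF: "finite F" using F matroid_finite[OF M] by (meson finite_Pow_iff finite_subset)
  have finE: "finite T" if "T \<subseteq> ground M" for T
    using that matroid_finite[OF M] finite_subset by blast
  obtain P where finP: "finite P" and part: "partition_on S P"
    and PC: "\<And>C. C \<in> P \<Longrightarrow> connected_component_of C (restriction M S)"
    and rk: "\<And>T. T \<subseteq> S \<Longrightarrow> rk M T = (\<Sum>C\<in>P. rk M (T \<inter> C))"
    using component_decomposition[OF M SE] by metis
  have PS: "\<Union>P = S" and disj: "\<And>C D. C \<in> P \<Longrightarrow> D \<in> P \<Longrightarrow> C \<noteq> D \<Longrightarrow> C \<inter> D = {}"
    using part by (auto simp: partition_on_def disjoint_def)
  have PF: "C \<in> F" and Psub: "C \<subset> S" and Psep: "rk M C + rk M (S - C) = rk M S" if "C \<in> P" for C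
    using comp[OF less.prems(1) PC[OF that]] connected_component_ofD[OF M SE PC[OF that]]
      less.prems(2) by auto
  \<comment> \<open>The empty set is left out because it lies in every component; its coefficient is zero.\<close>
  define G where "G C = {T \<in> F. T \<subseteq> C \<and> T \<noteq> {}}" for C
  have finG: "finite (G C)" for C using finF by (simp add: G_def)
  have sumG: "(\<Sum>T\<in>G C. coeff F M T) = nullity M C" if "C \<in> P" for C
  proof -
    have "(\<Sum>T\<in>G C. coeff F M T) = (\<Sum>T\<in>{T \<in> F. T \<subseteq> C}. coeff F M T)"
      using finF coeff_empty[OF M] by (intro sum.mono_neutral_left) (auto simp: G_def)
    then show ?thesis using sum_coeff_subsets[OF finE PF[OF that]] Psub[OF that] SE by auto
  qed
  have zero: "coeff F M T = 0" if T: "T \<in> F" "T \<subset> S" "\<And>C. C \<in> P \<Longrightarrow> T \<notin> G C" for T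
  proof (cases "T = {}")
    case True
    then show ?thesis using coeff_empty[OF M] by simp
  next
    case False
    then obtain C where C: "C \<in> P" "T \<inter> C \<noteq> {}" using T(2) PS by blast
    have "\<not> T \<subseteq> C" using T(3)[OF C(1)] T(1) False by (auto simp: G_def)
    then have "T \<inter> C \<subset> T" by blast
    moreover have "T \<inter> (S - C) = T - T \<inter> C" using T(2) by blast
    then have "rk M (T \<inter> C) + rk M (T - T \<inter> C) = rk M T"
      using separator_additive[OF M SE _ Psep[OF C(1)], of T] Psub[OF C(1)] T(2) by auto
    moreover have TE: "T \<subseteq> ground M" using T(2) SE by blast
    ultimately have "\<not> matroid_connected (restriction M T)"
      unfolding connected_restriction_iff[OF M TE] using C(2) by metis
    moreover have "card T < card S" using T(2) finE[OF SE] psubset_card_mono by blast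
    ultimately show ?thesis using less.hyps T(1) by blast
  qed
  have cardS: "card S = (\<Sum>C\<in>P. card C)"
    using card_Union_disjoint[of P] part PS finE Psub SE
    by (metis finite_subset partition_onD2 psubset_imp_subset)
  have "(\<Sum>T\<in>{T \<in> F. T \<subset> S}. coeff F M T) = (\<Sum>T\<in>(\<Union>C\<in>P. G C). coeff F M T)"
  proof (rule sum.mono_neutral_right)
    show "(\<Union>C\<in>P. G C) \<subseteq> {T \<in> F. T \<subset> S}" using Psub by (fastforce simp: G_def)
  qed (use finF zero in auto)
  also have "\<dots> = (\<Sum>C\<in>P. \<Sum>T\<in>G C. coeff F M T)"
  proof (rule sum.UNION_disjoint[OF finP])
    show "\<forall>i\<in>P. \<forall>j\<in>P. i \<noteq> j \<longrightarrow> G i \<inter> G j = {}"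
    proof (intro ballI impI)
      fix C D assume "C \<in> P" "D \<in> P" "C \<noteq> D"
      then have "C \<inter> D = {}" by (rule disj)
      then show "G C \<inter> G D = {}" unfolding G_def by blast
    qed
  qed (use finG in auto)
  also have "\<dots> = (\<Sum>C\<in>P. nullity M C)" using sumG by simp
  also have "\<dots> = nullity M S"
  proof -
    have "rk M S = (\<Sum>C\<in>P. rk M C)"
      using rk[of S] Psub by (simp add: Int_absorb1 psubset_imp_subset)
    then show ?thesis using cardS by (simp add: nullity_def sum_subtractf)
  qed
  finally show ?case by (simp add: coeff.simps[of F M S])
qed

lemma expected_codim_wrt_connected_members:
  assumes M: "is_matroid M" and F: "F \<subseteq> Pow (ground M)"
    and comp: "\<And>S C. S \<in> F \<Longrightarrow> connected_component_of C (restriction M S) \<Longrightarrow> C \<in> F"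
  shows "expected_codim_wrt F M
    = expected_codim_wrt {S \<in> F. matroid_connected (restriction M S)} M"
proof (rule expected_codim_wrt_delete_zeros)
  show "finite F" using F matroid_finite[OF M] by (meson finite_Pow_iff finite_subset)
  show "finite S" if "S \<in> F" for S using that F matroid_finite[OF M] finite_subset by blast
  show "coeff F M S = 0" if "S \<in> F - {S \<in> F. matroid_connected (restriction M S)}" for S
    using coeff_disconnected[OF M F] comp that by blast
qed blast

section \<open>The dual matroid\<close>

definition dual :: "'a matroid \<Rightarrow> 'a matroid" where
  "dual M = \<lparr>ground = ground M,
     rk = (\<lambda>T. card T + rk M (ground M - T) - rk M (ground M))\<rparr>"

lemma ground_dual [simp]: "ground (dual M) = ground M"
  by (simp add: dual_def)

lemma int_rk_dual:
  assumes M: "is_matroid M" and T: "T \<subseteq> ground M"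
  shows "int (rk (dual M) T) = int (card T) + int (rk M (ground M - T)) - int (rk M (ground M))"
proof -
  have "T \<union> (ground M - T) = ground M" using T by blast
  then have "rk M (ground M) \<le> rk M T + rk M (ground M - T)"
    using rk_submodular[OF M T, of "ground M - T"] by auto
  then show ?thesis using rk_le_card[OF M T] by (simp add: dual_def of_nat_diff)
qed

lemma is_matroid_dual:
  assumes M: "is_matroid M"
  shows "is_matroid (dual M)"
  unfolding is_matroid_def ground_dual
proof (intro conjI allI impI)
  let ?E = "ground M"
  note dual = int_rk_dual[OF M]
  have fin: "finite A" if "A \<subseteq> ?E" for A using that matroid_finite[OF M] finite_subset by blast
  show "finite ?E" by (rule matroid_finite[OF M])
  show "rk (dual M) A \<le> card A" if A: "A \<subseteq> ?E" for A
    using dual[OF A] rk_mono[OF M, of "?E - A" ?E] by simp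
  show "rk (dual M) A \<le> rk (dual M) B" if "A \<subseteq> B" and B: "B \<subseteq> ?E" for A B
  proof -
    have A: "A \<subseteq> ?E" using that by blast
    \<comment> \<open>Passing from \<open>E - B\<close> to \<open>E - A\<close> adds \<open>B - A\<close>, which raises the rank by at most its size.\<close>
    have un: "(?E - B) \<union> (B - A) = ?E - A" using that by blast
    have "B - A \<subseteq> ?E" using B by blast
    then have "rk M (?E - A) \<le> rk M (?E - B) + rk M (B - A)"
      using rk_submodular[OF M, of "?E - B" "B - A"] unfolding un by simp
    also have "rk M (B - A) \<le> card (B - A)" using rk_le_card[OF M, of "B - A"] B by auto
    also have "card (B - A) = card B - card A"
      using card_Diff_subset[OF fin[OF A] \<open>A \<subseteq> B\<close>] .
    finally show ?thesis using dual[OF A] dual[OF B] card_mono[OF fin[OF B] \<open>A \<subseteq> B\<close>] by linarith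
  qed
  show "rk (dual M) (A \<union> B) + rk (dual M) (A \<inter> B) \<le> rk (dual M) A + rk (dual M) B"
    if A: "A \<subseteq> ?E" and B: "B \<subseteq> ?E" for A B
  proof -
    have "(?E - A) \<union> (?E - B) = ?E - A \<inter> B" "(?E - A) \<inter> (?E - B) = ?E - (A \<union> B)" by auto
    then have "rk M (?E - A \<inter> B) + rk M (?E - (A \<union> B)) \<le> rk M (?E - A) + rk M (?E - B)"
      using rk_submodular[OF M, of "?E - A" "?E - B"] by auto
    moreover have "card (A \<union> B) + card (A \<inter> B) = card A + card B"
      using card_Un_Int[OF fin[OF A] fin[OF B]] by simp
    moreover have "A \<union> B \<subseteq> ?E" "A \<inter> B \<subseteq> ?E" using A B by auto
    ultimately show ?thesis
      using dual[OF A] dual[OF B] dual[of "A \<union> B"] dual[of "A \<inter> B"] by linarith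
  qed
qed

lemma connected_restriction_dual_iff:
  assumes M: "is_matroid M" and S: "S \<subseteq> ground M"
  shows "matroid_connected (restriction (dual M) (ground M - S)) \<longleftrightarrow>
    matroid_connected (contraction M S)"
proof -
  let ?E = "ground M"
  have "rk (dual M) A + rk (dual M) (?E - S - A) = rk (dual M) (?E - S) \<longleftrightarrow>
      rk M (A \<union> S) + rk M (?E - A) = rk M ?E + rk M S" if A: "A \<subseteq> ?E - S" for A
  proof -
    have "?E - (?E - S - A) = A \<union> S" "?E - (?E - S) = S" using S A by auto
    moreover have "finite (?E - S)" using matroid_finite[OF M] by blast
    then have "card (?E - S) = card A + card (?E - S - A)"
      using A by (metis card_Diff_subset card_mono finite_subset le_add_diff_inverse)
    moreover have "A \<subseteq> ?E" "?E - S - A \<subseteq> ?E" "?E - S \<subseteq> ?E" using A by auto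
    ultimately show ?thesis
      using int_rk_dual[OF M, of A] int_rk_dual[OF M, of "?E - S - A"]
        int_rk_dual[OF M, of "?E - S"] by auto
  qed
  then show ?thesis
    using connected_restriction_iff[OF is_matroid_dual[OF M], of "?E - S"]
      connected_contraction_iff[OF M S] by (auto simp: psubset_imp_subset)
qed

lemma connected_contraction_dual_iff:
  assumes M: "is_matroid M" and S: "S \<subseteq> ground M"
  shows "matroid_connected (contraction (dual M) (ground M - S)) \<longleftrightarrow>
    matroid_connected (restriction M S)"
proof -
  let ?E = "ground M"
  have SS: "?E - (?E - S) = S" using S by auto
  have "rk (dual M) (A \<union> (?E - S)) + rk (dual M) (?E - A)
        = rk (dual M) ?E + rk (dual M) (?E - S) \<longleftrightarrow>
      rk M A + rk M (S - A) = rk M S" if A: "A \<subseteq> S" for A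
  proof -
    have "?E - (A \<union> (?E - S)) = S - A" "?E - (?E - A) = A" using S A by auto
    moreover have "finite ?E" using matroid_finite[OF M] .
    then have "card (A \<union> (?E - S)) = card A + card (?E - S)"
      "card ?E = card A + card (?E - A)"
      using A S by (auto intro!: card_Un_disjoint intro: finite_subset)
        (metis card_Diff_subset card_mono finite_subset le_add_diff_inverse subset_trans)
    moreover have "A \<union> (?E - S) \<subseteq> ?E" "?E - A \<subseteq> ?E" "?E - S \<subseteq> ?E" using A S by auto
    ultimately show ?thesis
      using int_rk_dual[OF M, of "A \<union> (?E - S)"] int_rk_dual[OF M, of "?E - A"]
        int_rk_dual[OF M, of "?E - S"] int_rk_dual[OF M, of ?E] SS is_matroid_rk_empty[OF M]
      by auto
  qed
  then show ?thesis
    using connected_contraction_iff[OF is_matroid_dual[OF M], of "?E - S"]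
      connected_restriction_iff[OF M S] by (auto simp: psubset_imp_subset SS)
qed

text \<open>
  With \<open>a\<close> the coefficients of \<open>F\<close> in \<open>M\<close>, and \<open>b(T)\<close> the coefficient of \<open>E - T\<close> for the family of
  complements in the dual, both sides are the sum of \<open>a(S) b(T)\<close> over the pairs \<open>S \<subseteq> T\<close> in \<open>F\<close>: on
  the left the sum over \<open>T\<close> has been carried out and yields \<open>k - rk S\<close>, on the right the sum over \<open>S\<close>
  yields \<open>c(T)\<close>, which is the corank of \<open>E - T\<close> in the dual.
\<close>

lemma expected_codim_wrt_dual:
  assumes M: "is_matroid M" and F: "F \<subseteq> Pow (ground M)"
  shows "expected_codim_wrt F M = expected_codim_wrt ((\<lambda>S. ground M - S) ` F) (dual M)"
proof -
  let ?E = "ground M"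
  define F' where "F' = (\<lambda>S. ?E - S) ` F"
  define a where "a S = coeff F M S" for S
  define b where "b T = coeff F' (dual M) (?E - T)" for T
  have finE: "finite T" if "T \<subseteq> ?E" for T
    using that matroid_finite[OF M] finite_subset by blast
  have finF: "finite F" using F matroid_finite[OF M] by (meson finite_Pow_iff finite_subset)
  have sub: "S \<subseteq> ?E" if "S \<in> F" for S using F that by blast
  have cc: "?E - (?E - S) = S" if "S \<in> F" for S using sub[OF that] by blast
  have inj: "inj_on (\<lambda>S. ?E - S) F" by (rule inj_onI) (metis cc)
  have card: "int (card (?E - S)) = int (card ?E) - int (card S)" if "S \<in> F" for S
    using sub[OF that] matroid_finite[OF M]
    by (simp add: card_Diff_subset finite_subset card_mono of_nat_diff)
  have corank: "int (rk M ?E) - int (rk M S) = (\<Sum>T\<in>{T \<in> F. S \<subseteq> T}. b T)" if S: "S \<in> F" for S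
  proof -
    have "int (rk M ?E) - int (rk M S) = nullity (dual M) (?E - S)"
      using int_rk_dual[OF M, of "?E - S"] by (simp add: nullity_def cc[OF S])
    also have "\<dots> = (\<Sum>T\<in>{T \<in> F'. T \<subseteq> ?E - S}. coeff F' (dual M) T)"
      using sum_coeff_subsets[OF finE, of "?E - S" F' "dual M"] S by (auto simp: F'_def)
    also have "{T \<in> F'. T \<subseteq> ?E - S} = (\<lambda>T. ?E - T) ` {T \<in> F. S \<subseteq> T}"
      using sub S by (auto simp: F'_def)
    also have "(\<Sum>T\<in>\<dots>. coeff F' (dual M) T) = (\<Sum>T\<in>{T \<in> F. S \<subseteq> T}. b T)"
      unfolding b_def by (intro sum.reindex_cong[OF _ refl refl] inj_on_subset[OF inj]) auto
    finally show ?thesis .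
  qed
  have dual_corank: "int (rk (dual M) ?E) - int (rk (dual M) (?E - T)) = (\<Sum>S\<in>{S \<in> F. S \<subseteq> T}. a S)"
    if T: "T \<in> F" for T
    using int_rk_dual[OF M, of ?E] int_rk_dual[OF M, of "?E - T"] card[OF T] cc[OF T]
      sum_coeff_subsets[OF finE[OF sub[OF T]] T, of M] is_matroid_rk_empty[OF M]
    by (simp add: nullity_def a_def)
  have "expected_codim_wrt F M = (\<Sum>S\<in>F. (\<Sum>T\<in>{T \<in> F. S \<subseteq> T}. b T) * a S)"
    unfolding expected_codim_wrt_def a_def[symmetric] using corank by simp
  also have "\<dots> = (\<Sum>S\<in>F. \<Sum>T\<in>F. if S \<subseteq> T then b T * a S else 0)"
    using finF by (simp add: sum_distrib_right sum.inter_filter[symmetric])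
  also have "\<dots> = (\<Sum>T\<in>F. \<Sum>S\<in>F. if S \<subseteq> T then b T * a S else 0)"
    by (rule sum.swap)
  also have "\<dots> = (\<Sum>T\<in>F. \<Sum>S\<in>F. if S \<subseteq> T then a S * b T else 0)"
    by (intro sum.cong refl) (simp add: mult.commute)
  also have "\<dots> = (\<Sum>T\<in>F. (\<Sum>S\<in>{S \<in> F. S \<subseteq> T}. a S) * b T)"
    using finF by (simp add: sum_distrib_right sum.inter_filter[symmetric])
  also have "\<dots> = (\<Sum>T\<in>F. (int (rk (dual M) ?E) - int (rk (dual M) (?E - T))) * b T)"
    using dual_corank by simp
  also have "\<dots> = expected_codim_wrt F' (dual M)"
    unfolding expected_codim_wrt_def b_def F'_def by (simp add: sum.reindex[OF inj])
  finally show ?thesis unfolding F'_def .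
qed

section \<open>Reduction to the sets with connected restriction and contraction\<close>

text \<open>
  Let \<open>A, B\<close> separate \<open>M/C\<close>. Contracting further to the connected \<open>M/S\<close>, one part must vanish, so
  it lies in \<open>S - C\<close>. There contracting \<open>C\<close> does not change its rank, because \<open>C\<close> is a direct summand
  of \<open>M|S\<close>; hence it is a direct summand not only of \<open>M/C\<close> but of the connected matroid \<open>M\<close>.
\<close>

lemma contraction_component_connected:
  assumes M: "is_matroid M" and con: "matroid_connected M" and S: "S \<subseteq> ground M"
    and conS: "matroid_connected (contraction M S)"
    and C: "C \<subseteq> S" "rk M C + rk M (S - C) = rk M S"
  shows "matroid_connected (contraction M C)"
proof (rule ccontr)
  let ?E = "ground M"
  have CE: "C \<subseteq> ?E" using C S by blast
  assume "\<not> matroid_connected (contraction M C)"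
  then obtain A where A: "A \<noteq> {}" "A \<subset> ?E - C"
    and eq: "rk M (A \<union> C) + rk M (?E - A) = rk M ?E + rk M C"
    using connected_contraction_iff[OF M CE] by blast
  have key: False
    if X: "X \<noteq> {}" "X \<subset> ?E - C" "rk M (X \<union> C) + rk M (?E - X) = rk M ?E + rk M C" "X \<subseteq> S" for X
  proof -
    have "(X \<union> C) \<inter> C = C" "(X \<union> C) \<inter> (S - C) = X" "X \<union> C \<subseteq> S" using X C by auto
    then have "rk M (X \<union> C) = rk M C + rk M X"
      using separator_additive[OF M S C, of "X \<union> C"] by simp
    then have "rk M X + rk M (?E - X) = rk M ?E" using X(3) by simp
    moreover have "X \<subset> ?E" using X(2) by blast
    ultimately show False using con matroid_connected_iff[OF M] X(1) by blast
  qed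
  define B where "B = ?E - C - A"
  have B: "B \<noteq> {}" "B \<subset> ?E - C" and EA: "?E - A = B \<union> C" and EB: "?E - B = A \<union> C"
    using A CE by (auto simp: B_def)
  have eqB: "rk M (B \<union> C) + rk M (?E - B) = rk M ?E + rk M C" using eq EA EB by simp
  have "rk M (A \<union> S) + rk M (B \<union> S) = rk M ?E + rk M S"
  proof (rule antisym)
    have sub: "A \<union> C \<subseteq> ?E" "B \<union> C \<subseteq> ?E" "C \<union> (S \<inter> A) \<subseteq> ?E"
      using A B S CE by blast+
    have un: "(A \<union> C) \<union> S = A \<union> S" "(A \<union> C) \<inter> S = C \<union> (S \<inter> A)"
      "(B \<union> C) \<union> (C \<union> (S \<inter> A)) = B \<union> S" "(B \<union> C) \<inter> (C \<union> (S \<inter> A)) = C"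
      using C S A by (auto simp: B_def)
    have "rk M (A \<union> S) + rk M (C \<union> (S \<inter> A)) \<le> rk M (A \<union> C) + rk M S"
      using rk_submodular[OF M sub(1) S] unfolding un .
    moreover have "rk M (B \<union> S) + rk M C \<le> rk M (B \<union> C) + rk M (C \<union> (S \<inter> A))"
      using rk_submodular[OF M sub(2,3)] unfolding un .
    ultimately show "rk M (A \<union> S) + rk M (B \<union> S) \<le> rk M ?E + rk M S" using eq EA by simp
  next
    have un: "(A \<union> S) \<union> (B \<union> S) = ?E" "(A \<union> S) \<inter> (B \<union> S) = S"
      using C S A by (auto simp: B_def)
    have "A \<union> S \<subseteq> ?E" "B \<union> S \<subseteq> ?E" using A B S by blast+
    from rk_submodular[OF M this]
    show "rk M ?E + rk M S \<le> rk M (A \<union> S) + rk M (B \<union> S)" unfolding un .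
  qed
  moreover have "A - S \<union> S = A \<union> S" "?E - (A - S) = B \<union> S"
    using A C S by (auto simp: B_def)
  ultimately have "rk M (A - S \<union> S) + rk M (?E - (A - S)) = rk M ?E + rk M S" by simp
  then have "A - S = {} \<or> \<not> A - S \<subset> ?E - S"
    using conS unfolding connected_contraction_iff[OF M S] by metis
  then consider "A \<subseteq> S" | "B \<subseteq> S" using A C unfolding B_def by blast
  then show False
  proof cases
    case 1 show False by (rule key[OF A eq 1])
  next
    case 2 show False by (rule key[OF B eqB 2])
  qed
qed

lemma expected_codim_wrt_biconnected:
  assumes M: "is_matroid M" and con: "matroid_connected M" and F: "F \<subseteq> Pow (ground M)"
    and bicon: "\<And>S. S \<subseteq> ground M \<Longrightarrow> matroid_connected (restriction M S) \<Longrightarrow>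
           matroid_connected (contraction M S) \<Longrightarrow> S \<in> F"
    and comp: "\<And>S C. S \<in> F \<Longrightarrow> connected_component_of C (restriction M S) \<Longrightarrow> C \<in> F"
  shows "expected_codim_wrt F M = expected_codim_wrt
    {S. S \<subseteq> ground M \<and> matroid_connected (restriction M S) \<and> matroid_connected (contraction M S)} M"
    (is "_ = expected_codim_wrt ?B M")
proof -
  let ?E = "ground M"
  let ?co = "\<lambda>S. ?E - S"
  define G where "G = {S \<in> F. matroid_connected (restriction M S)}"
  have GE: "G \<subseteq> Pow ?E" using F by (auto simp: G_def)
  have D: "is_matroid (dual M)" by (rule is_matroid_dual[OF M])
  have conD: "matroid_connected (dual M)"
  proof -
    \<comment> \<open>The dual is its own contraction by the empty set, which is dual to \<open>M|E\<close>.\<close>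
    have "matroid_connected (restriction M ?E)"
      using con connected_restriction_iff[OF M, of ?E] matroid_connected_iff[OF M] by simp
    then have "matroid_connected (contraction (dual M) {})"
      using connected_contraction_dual_iff[OF M, of ?E] by simp
    then show ?thesis
      using connected_contraction_iff[OF D, of "{}"] matroid_connected_iff[OF D]
        is_matroid_rk_empty[OF D] by simp
  qed
  have compD: "C \<in> ?co ` G"
    if S': "S' \<in> ?co ` G" and C: "connected_component_of C (restriction (dual M) S')" for S' C
  proof -
    obtain S where S: "S \<in> G" "S' = ?E - S" using S' by blast
    have SE: "S \<subseteq> ?E" "S' \<subseteq> ground (dual M)" using S GE by auto
    note CD = connected_component_ofD[OF D SE(2) C]
    have CE: "C \<subseteq> ?E" "?E - C \<subseteq> ?E" using CD(1) SE by auto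
    have cc: "?E - (?E - C) = C" using CE by blast
    have "matroid_connected (contraction (dual M) S')"
      using connected_contraction_dual_iff[OF M SE(1)] S by (simp add: G_def)
    then have "matroid_connected (contraction (dual M) C)"
      using contraction_component_connected[OF D conD SE(2) _ CD(1,3)] by blast
    then have "matroid_connected (restriction M (?E - C))"
      using connected_contraction_dual_iff[OF M CE(2)] cc by simp
    moreover have "matroid_connected (contraction M (?E - C))"
      using connected_restriction_dual_iff[OF M CE(2)] cc CD(2) by simp
    ultimately have "?E - C \<in> G" using bicon[OF CE(2)] by (simp add: G_def)
    then show ?thesis using cc by (metis imageI)
  qed
  have "expected_codim_wrt F M = expected_codim_wrt G M"
    unfolding G_def using expected_codim_wrt_connected_members[OF M F] comp by blast
  also have "\<dots> = expected_codim_wrt (?co ` G) (dual M)"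
    by (rule expected_codim_wrt_dual[OF M GE])
  also have "\<dots> = expected_codim_wrt
      {S' \<in> ?co ` G. matroid_connected (restriction (dual M) S')} (dual M)"
  proof (rule expected_codim_wrt_connected_members[OF D])
    show "?co ` G \<subseteq> Pow (ground (dual M))" by auto
  qed (rule compD)
  also have "{S' \<in> ?co ` G. matroid_connected (restriction (dual M) S')} = ?co ` ?B"
    using connected_restriction_dual_iff[OF M] GE bicon by (auto simp: G_def)
  also have "expected_codim_wrt (?co ` ?B) (dual M) = expected_codim_wrt ?B M"
    by (rule expected_codim_wrt_dual[OF M, symmetric]) blast
  finally show ?thesis .
qed

theorem theorem3p6:
  fixes M :: "'a matroid" and SS :: "'a set set"
  assumes "is_matroid M"
    and "matroid_connected M"
    and "SS \<subseteq> Pow (ground M)"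
    and "\<And>S. S \<subseteq> ground M \<Longrightarrow> matroid_connected (restriction M S) \<Longrightarrow>
           matroid_connected (contraction M S) \<Longrightarrow> S \<in> SS"
    and "\<And>S C. S \<in> SS \<Longrightarrow> connected_component_of C (restriction M S) \<Longrightarrow> C \<in> SS"
  shows "expected_codim_wrt SS M = expected_codim M"
proof -
  have "C \<in> Pow (ground M)"
    if "S \<in> Pow (ground M)" "connected_component_of C (restriction M S)" for S C
    using connected_component_ofD(1)[OF assms(1) _ that(2)] that(1) by blast
  then have "expected_codim M = expected_codim_wrt {S. S \<subseteq> ground M \<and>
      matroid_connected (restriction M S) \<and> matroid_connected (contraction M S)} M"
    unfolding expected_codim_def
    by (intro expected_codim_wrt_biconnected[OF assms(1,2)]) auto
  then show ?thesis using expected_codim_wrt_biconnected[OF assms] by simp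
qed

end
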